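(* Let $d_1,\dots,d_k$ be distinct positive integers and let $m$ be their least common multiple. Suppose $f(x)\in\mathbb{Q}[x]$ satisfies $\deg f(x)<\sum_{j=1}^{k}\phi(d_j)$ (where $\phi$ is Euler's totient function) and no root of $f$ is an $m$-th root of unity. Then $$f(x)\prod_{j=1}^{k}\frac{1}{\Phi_{d_j}(x)}=\sum_{j=1}^{k}\frac{\big(-f(x)\,g(x)\,x\,\Phi_{d_j}'(x)\big)\ \mathrm{rem}\ \Phi_{d_j}(x)}{m\,\Phi_{d_j}(x)},$$ where $g(x)=(1-x^m)\big/\prod_{j=1}^{k}\Phi_{d_j}(x)$.
   Context: $\Phi_n(x)$ is the $n$-th cyclotomic polynomial, with the convention $\Phi_1(x)=1-x$ (so that $1-x^m=\prod_{d\mid m}\Phi_d(x)$); for $n\ge2$ it is the usual (monic) cyclotomic polynomial. $\Phi_n'$ is its derivative. For $f,p\in\mathbb{Q}[x]$ with $p\neq0$, $f\ \mathrm{rem}\ p$ denotes the remainder of $f$ on Euclidean division by $p$ (the unique polynomial of degree $<\deg p$ congruent to $f$ modulo $p$). *)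

theory Defs
  imports
    "HOL-Computational_Algebra.Computational_Algebra"
    "HOL-Number_Theory.Totient"
begin

definition primitive_roots_of_unity :: "nat \<Rightarrow> complex set" where
  "primitive_roots_of_unity n = {z. z ^ n = 1 \<and> (\<forall>k. 0 < k \<and> k < n \<longrightarrow> z ^ k \<noteq> 1)}"

(* A rational polynomial whose image in C[x] is the product of x - z over the primitive n-th
   roots of unity z; only for n = 1 the sign is changed, giving 1 - x instead of x - 1.
   The lemma of_rat_cyclotomic_poly shows that the polynomial described by THE exists and is unique.
   The index n = 0 is not meaningful. *)
definition cyclotomic_poly :: "nat \<Rightarrow> rat poly" where
  "cyclotomic_poly n =
     (if n = 1 then [:1, -1:]
      else (THE p. map_poly of_rat p = (\<Prod>z\<in>primitive_roots_of_unity n. [:-z, 1:])))"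

abbreviation of_rat_poly :: "rat poly \<Rightarrow> complex poly" where
  "of_rat_poly \<equiv> map_poly of_rat"

lemma of_rat_poly_add: "of_rat_poly (p + q) = of_rat_poly p + of_rat_poly q"
  by (intro poly_eqI) (simp add: coeff_map_poly of_rat_add)

lemma of_rat_poly_diff: "of_rat_poly (p - q) = of_rat_poly p - of_rat_poly q"
  by (intro poly_eqI) (simp add: coeff_map_poly of_rat_diff)

lemma of_rat_poly_mult: "of_rat_poly (p * q) = of_rat_poly p * of_rat_poly q"
  by (intro poly_eqI) (simp add: coeff_map_poly coeff_mult of_rat_sum of_rat_mult)

lemma of_rat_poly_prod: "of_rat_poly (\<Prod>x\<in>A. f x) = (\<Prod>x\<in>A. of_rat_poly (f x))"
  by (induction A rule: infinite_finite_induct) (simp_all add: of_rat_poly_mult)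

lemma of_rat_poly_eq_iff: "of_rat_poly p = of_rat_poly q \<longleftrightarrow> p = q"
  by (auto simp: poly_eq_iff coeff_map_poly)

lemma degree_of_rat_poly: "degree (of_rat_poly p) = degree p"
  by (rule degree_map_poly) auto

lemma of_rat_poly_quotient:
  assumes "of_rat_poly a = of_rat_poly c * P" "c \<noteq> 0"
  shows   "P = of_rat_poly (a div c)"
proof (rule ccontr)
  assume neq: "P \<noteq> of_rat_poly (a div c)"
  have "of_rat_poly c * P = of_rat_poly (c * (a div c) + a mod c)"
    using assms(1) by simp
  also have "\<dots> = of_rat_poly c * of_rat_poly (a div c) + of_rat_poly (a mod c)"
    by (simp only: of_rat_poly_add of_rat_poly_mult)
  finally have eq: "of_rat_poly (a mod c) = of_rat_poly c * (P - of_rat_poly (a div c))"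
    by (simp add: algebra_simps)
  have c: "of_rat_poly c \<noteq> 0"
    using assms(2) of_rat_poly_eq_iff[of c 0] by simp
  with neq eq have "of_rat_poly (a mod c) \<noteq> 0"
    by simp
  hence "a mod c \<noteq> 0"
    by auto
  hence "degree (a mod c) < degree c"
    using assms(2) degree_mod_less by blast
  moreover have "degree (of_rat_poly (a mod c)) \<ge> degree (of_rat_poly c)"
    unfolding eq using neq c by (subst degree_mult_eq) auto
  ultimately show False
    by (simp add: degree_of_rat_poly)
qed

lemma prod_roots_of_unity:
  assumes "n > 0"
  shows   "(\<Prod>z | z ^ n = 1. [:-z, 1:]) = monom 1 n - (1 :: complex poly)"
proof (rule poly_eqI_degree_lead_coeff[where A = "{z. z ^ n = 1}" and n = n])
  let ?p = "\<Prod>z | z ^ n = (1 :: complex). [:-z, 1:]"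
  have fin: "finite {z::complex. z ^ n = 1}"
    using assms by (intro finite_roots_unity) auto
  have deg: "degree ?p = n"
    by (subst degree_prod_sum_eq) (simp_all add: card_roots_unity_eq assms)
  have "lead_coeff ?p = 1"
    by (simp add: lead_coeff_prod)
  with deg assms show "coeff ?p n = coeff (monom 1 n - 1) n"
    by simp
  show "degree ?p \<le> n"
    using deg by simp
  show "degree (monom 1 n - (1 :: complex poly)) \<le> n"
    by (intro degree_diff_le) (simp_all add: degree_monom_eq)
  show "n \<le> card {z::complex. z ^ n = 1}"
    by (simp add: card_roots_unity_eq assms)
  fix z :: complex assume "z \<in> {z. z ^ n = 1}"
  thus "poly ?p z = poly (monom 1 n - 1) z"
    using fin by (auto simp: poly_prod poly_monom prod_zero_iff)
qed

lemma roots_of_unity_eq_UN_primitive: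
  assumes "n > 0"
  shows   "{z. z ^ n = 1} = (\<Union>d\<in>{d. d dvd n}. primitive_roots_of_unity d)"
proof (intro equalityI subsetI)
  fix z :: complex assume z: "z \<in> {z. z ^ n = 1}"
  define d where "d = (LEAST d. d > 0 \<and> z ^ d = 1)"
  have d: "d > 0 \<and> z ^ d = 1"
    unfolding d_def by (rule LeastI[of _ n]) (use z assms in auto)
  have least: "z ^ k \<noteq> 1" if "0 < k" "k < d" for k
    using not_less_Least[of k "\<lambda>d. d > 0 \<and> z ^ d = 1"] that unfolding d_def by auto
  have "z ^ n = z ^ (d * (n div d) + n mod d)"
    by simp
  also have "\<dots> = z ^ (n mod d)"
    using d by (simp only: power_add power_mult) simp
  finally have "n mod d = 0"
    using z least[of "n mod d"] d by auto
  thus "z \<in> (\<Union>d\<in>{d. d dvd n}. primitive_roots_of_unity d)"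
    using d least by (auto simp: primitive_roots_of_unity_def)
next
  fix z assume "z \<in> (\<Union>d\<in>{d. d dvd n}. primitive_roots_of_unity d)"
  thus "z \<in> {z. z ^ n = 1}"
    by (auto simp: primitive_roots_of_unity_def power_mult elim!: dvdE)
qed

lemma disjoint_primitive_roots_of_unity:
  assumes "0 < c" "0 < d" "c \<noteq> d"
  shows   "primitive_roots_of_unity c \<inter> primitive_roots_of_unity d = {}"
  using assms by (cases c d rule: linorder_cases) (auto simp: primitive_roots_of_unity_def)

lemma finite_primitive_roots_of_unity:
  assumes "n > 0"
  shows   "finite (primitive_roots_of_unity n)"
  by (rule finite_subset[OF _ finite_roots_unity[of n]])
     (use assms in \<open>auto simp: primitive_roots_of_unity_def\<close>)

lemma prod_primitive_roots_of_unity: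
  assumes "n > 0"
  shows   "(\<Prod>d | d dvd n. \<Prod>z\<in>primitive_roots_of_unity d. [:-z, 1:]) = monom 1 n - 1"
proof -
  have "(\<Prod>d | d dvd n. \<Prod>z\<in>primitive_roots_of_unity d. [:-z, 1:]) =
        (\<Prod>z\<in>(\<Union>d\<in>{d. d dvd n}. primitive_roots_of_unity d). [:-z, 1:])"
  proof (rule prod.UNION_disjoint [symmetric])
    have pos: "d > 0" if "d dvd n" for d
      using that assms by (rule dvd_pos_nat[rotated])
    show "finite {d. d dvd n}"
      using assms by simp
    show "\<forall>d\<in>{d. d dvd n}. finite (primitive_roots_of_unity d)"
      using pos finite_primitive_roots_of_unity by blast
    show "\<forall>c\<in>{d. d dvd n}. \<forall>d\<in>{d. d dvd n}. c \<noteq> d \<longrightarrow>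
            primitive_roots_of_unity c \<inter> primitive_roots_of_unity d = {}"
      using pos disjoint_primitive_roots_of_unity by blast
  qed
  thus ?thesis
    using assms by (simp add: prod_roots_of_unity flip: roots_of_unity_eq_UN_primitive)
qed

lemma ex_cyclotomic_poly:
  assumes "n > 0"
  shows   "\<exists>p. of_rat_poly p = (\<Prod>z\<in>primitive_roots_of_unity n. [:-z, 1:])"
  using assms
proof (induction n rule: less_induct)
  case (less n)
  let ?P = "\<lambda>d. \<Prod>z\<in>primitive_roots_of_unity d. [:-z, 1:]"
  let ?D = "{d. d dvd n \<and> d \<noteq> n}"
  have D: "{d. d dvd n} = insert n ?D" "finite ?D"
    using less.prems by auto
  have "\<exists>p. of_rat_poly p = ?P d" if "d \<in> ?D" for d
  proof (rule less.IH)
    from that have "d dvd n" "d \<noteq> n"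
      by simp_all
    thus "d < n"
      using dvd_imp_le[of d n] less.prems by linarith
    show "0 < d"
      using less.prems \<open>d dvd n\<close> by (rule dvd_pos_nat)
  qed
  then obtain q where q: "\<And>d. d \<in> ?D \<Longrightarrow> of_rat_poly (q d) = ?P d"
    by metis
  define c where "c = (\<Prod>d\<in>?D. q d)"
  have c: "of_rat_poly c = (\<Prod>d\<in>?D. ?P d)"
    unfolding c_def of_rat_poly_prod using q by (intro prod.cong) auto
  have "?P d \<noteq> 0" for d
    by (cases "finite (primitive_roots_of_unity d)") (auto simp: prod_zero_iff)
  hence "of_rat_poly c \<noteq> 0"
    unfolding c using D(2) by (subst prod_zero_iff) auto
  hence "c \<noteq> 0"
    by auto
  have "of_rat_poly (monom 1 n - 1) = monom 1 n - 1"
    by (simp add: of_rat_poly_diff map_poly_monom)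
  also have "\<dots> = of_rat_poly c * ?P n"
    unfolding c prod_primitive_roots_of_unity[OF less.prems, symmetric] D(1)
    using D(2) by (subst prod.insert) (auto simp: mult.commute)
  finally show ?case
    using of_rat_poly_quotient[OF _ \<open>c \<noteq> 0\<close>] by metis
qed

lemma of_rat_cyclotomic_poly:
  assumes "n \<ge> 2"
  shows   "map_poly of_rat (cyclotomic_poly n) = (\<Prod>z\<in>primitive_roots_of_unity n. [:-z, 1:])"
proof -
  have "\<exists>!p. of_rat_poly p = (\<Prod>z\<in>primitive_roots_of_unity n. [:-z, 1:])"
    using ex_cyclotomic_poly[of n] assms of_rat_poly_eq_iff by (metis Suc_1 Suc_le_lessD gr0I not_less0)
  from theI'[OF this] show ?thesis
    using assms by (simp add: cyclotomic_poly_def)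
qed

lemma of_rat_cyclotomic_poly_1:
  "of_rat_poly (cyclotomic_poly 1) = - (\<Prod>z\<in>primitive_roots_of_unity 1. [:-z, 1:])"
proof -
  have "primitive_roots_of_unity 1 = {1}"
    by (auto simp: primitive_roots_of_unity_def)
  thus ?thesis
    by (simp add: cyclotomic_poly_def map_poly_pCons)
qed

lemma prod_cyclotomic_poly:
  assumes "m > 0"
  shows   "(\<Prod>d | d dvd m. cyclotomic_poly d) = 1 - [:0, 1:] ^ m"
proof -
  let ?P = "\<lambda>d. \<Prod>z\<in>primitive_roots_of_unity d. [:-z, 1:]"
  have D: "{d. d dvd m} = insert 1 ({d. d dvd m} - {1})" "finite {d. d dvd m}"
    using assms by auto
  have "of_rat_poly (\<Prod>d | d dvd m. cyclotomic_poly d) =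
          of_rat_poly (cyclotomic_poly 1) *
          (\<Prod>d\<in>{d. d dvd m} - {1}. of_rat_poly (cyclotomic_poly d))"
    by (subst D(1), subst prod.insert) (use D(2) in \<open>auto simp: of_rat_poly_mult of_rat_poly_prod\<close>)
  also have "(\<Prod>d\<in>{d. d dvd m} - {1}. of_rat_poly (cyclotomic_poly d)) =
             (\<Prod>d\<in>{d. d dvd m} - {1}. ?P d)"
  proof (intro prod.cong refl of_rat_cyclotomic_poly)
    fix d assume "d \<in> {d. d dvd m} - {1}"
    with assms show "d \<ge> 2"
      by (cases "d = 0") auto
  qed
  also have "of_rat_poly (cyclotomic_poly 1) * \<dots> = - (?P 1 * (\<Prod>d\<in>{d. d dvd m} - {1}. ?P d))"
    by (simp only: of_rat_cyclotomic_poly_1 mult_minus_left)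
  also have "?P 1 * (\<Prod>d\<in>{d. d dvd m} - {1}. ?P d) = (\<Prod>d | d dvd m. ?P d)"
    using D(2) by (subst prod.remove[of _ 1]) auto
  also have "- \<dots> = of_rat_poly (1 - monom 1 m)"
    using assms by (simp add: prod_primitive_roots_of_unity of_rat_poly_diff map_poly_monom)
  finally show ?thesis
    by (simp only: of_rat_poly_eq_iff monom_altdef smult_1_left)
qed

lemma prod_cyclotomic_poly_dvd:
  fixes d :: "nat \<Rightarrow> nat"
  assumes "finite A" "inj_on d A" "\<And>j. j \<in> A \<Longrightarrow> d j > 0"
  shows   "(\<Prod>j\<in>A. cyclotomic_poly (d j)) dvd 1 - [:0, 1:] ^ Lcm (d ` A)"
proof -
  have "0 \<notin> d ` A"
    using assms(3) by fastforce
  hence pos: "Lcm (d ` A) > 0"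
    using assms(1) by (simp add: Lcm_0_iff flip: neq0_conv)
  have "(\<Prod>j\<in>A. cyclotomic_poly (d j)) = (\<Prod>e\<in>d ` A. cyclotomic_poly e)"
    using assms(2) by (simp add: prod.reindex)
  also have "\<dots> dvd (\<Prod>e | e dvd Lcm (d ` A). cyclotomic_poly e)"
    using pos by (intro prod_dvd_prod_subset) auto
  finally show ?thesis
    using pos by (simp add: prod_cyclotomic_poly)
qed

end

(* Write 1 - x^m = p_1 ... p_k g with p_j the d_j-th cyclotomic polynomial. Differentiating and
   multiplying by -x gives, modulo p_j, that m = m x^m is congruent to
   - x p_j' g times the product of the p_i with i \<noteq> j. Hence m f and the sum of the claimed
   numerators, each times the product of the other p_i, agree modulo every p_j. The p_j are
   pairwise coprime as 1 - x^m is squarefree, so the two sides agree modulo p_1 ... p_k, and they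
   are equal since both have degree less than that of p_1 ... p_k. *)
theory Submission
  imports Defs "HOL-Computational_Algebra.Field_as_Ring"
begin

lemma degree_less_dvd_imp_zero:
  fixes p q :: "'a::idom poly"
  assumes "p dvd q" "degree q < degree p"
  shows   "q = 0"
  by (rule ccontr) (use assms dvd_imp_degree_le[of p q] in simp)

text \<open>This is the squarefreeness of 1 - x^m in characteristic 0. By the product rule a common
  divisor of \<open>p\<close> and \<open>q\<close> divides the derivative -m x^(m-1), hence also m
  x^m; as it divides m (1 - x^m) too, it divides the nonzero constant m.\<close>

lemma coprime_factors_one_minus_X_power:
  fixes p q :: "'a::{field_char_0,field_gcd} poly"
  assumes dvd: "p * q dvd 1 - [:0, 1:] ^ m" and m: "m > 0"
  shows   "coprime p q"
proof (rule coprimeI)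
  fix c assume c: "c dvd p" "c dvd q"
  from dvd obtain r where r: "1 - [:0, 1:] ^ m = p * q * r"
    by (elim dvdE)
  have "c dvd pderiv (p * q * r)"
    using c by (simp add: pderiv_mult)
  also have "pderiv (p * q * r) = - (of_nat m * [:0, 1:] ^ (m - 1))"
    unfolding r [symmetric] using m
    by (simp add: pderiv_diff pderiv_power of_nat_poly pderiv_pCons)
  finally have "c dvd of_nat m * [:0, 1:] ^ (m - 1) * [:0, 1:]"
    unfolding dvd_minus_iff by (rule dvd_mult2)
  also have "\<dots> = of_nat m * [:0, 1:] ^ m"
    using m by (cases m) (simp_all only: power_Suc2 diff_Suc_1 mult.assoc)
  finally have 1: "c dvd of_nat m * [:0, 1:] ^ m" .
  have "c dvd of_nat m * (1 - [:0, 1:] ^ m)"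
    unfolding r using c by simp
  with 1 have "c dvd of_nat m * [:0, 1:] ^ m + of_nat m * (1 - [:0, 1:] ^ m)"
    by (rule dvd_add)
  hence "c dvd of_nat m"
    by (simp add: algebra_simps)
  moreover have "is_unit (of_nat m :: 'a poly)"
    using m by (simp add: of_nat_poly is_unit_const_poly_iff dvd_field_iff)
  ultimately show "is_unit c"
    using dvd_trans by blast
qed

text \<open>Differentiating p q = 1 - x^m and multiplying by x gives x p' q + x p q' = -m x^m = -m
  (1 - p q), so the cofactor is m q - x q'.\<close>

lemma factor_dvd_pderiv_one_minus_X_power:
  fixes p q :: "'a::field_char_0 poly"
  assumes eq: "p * q = 1 - [:0, 1:] ^ m" and m: "m > 0"
  shows   "p dvd of_nat m + [:0, 1:] * pderiv p * q"
proof -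
  have "pderiv p * q + p * pderiv q = - (of_nat m * [:0, 1:] ^ (m - 1))"
    using arg_cong[OF eq, of pderiv] m
    by (simp add: pderiv_mult pderiv_diff pderiv_power of_nat_poly pderiv_pCons algebra_simps)
  hence "[:0, 1:] * (pderiv p * q + p * pderiv q) = - (of_nat m * ([:0, 1:] * [:0, 1:] ^ (m - 1)))"
    by (simp only: mult_minus_right mult.left_commute)
  also have "[:0, 1:] * [:0, 1:] ^ (m - 1) = 1 - p * q"
    unfolding eq using m by (simp flip: power_Suc)
  finally have "of_nat m + [:0, 1:] * pderiv p * q = p * (of_nat m * q - [:0, 1:] * pderiv q)"
    by (simp only: distrib_left right_diff_distrib mult_minus_right mult_1_right
          mult.assoc mult.left_commute add.commute) (simp add: algebra_simps)
  thus ?thesis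
    by simp
qed

text \<open>The expansion with denominators cleared, so that divisibility and degrees in the
  polynomial ring suffice. Of the \<open>p j\<close> only their being factors of 1 - x^m
  matters.\<close>

lemma partial_fractions_one_minus_X_power:
  fixes p :: "'b \<Rightarrow> 'a::{field_char_0,field_gcd} poly"
  assumes fin: "finite A" and m: "m > 0"
    and eq: "(\<Prod>j\<in>A. p j) * g = 1 - [:0, 1:] ^ m"
    and deg: "degree f < degree (\<Prod>j\<in>A. p j)"
  shows "of_nat m * f =
         (\<Sum>j\<in>A. ((- (f * g * [:0, 1:] * pderiv (p j))) mod p j) * (\<Prod>i\<in>A - {j}. p i))"
proof -
  define Q where "Q = (\<lambda>j. \<Prod>i\<in>A - {j}. p i)"
  define R where "R = (\<lambda>j. (- (f * g * [:0, 1:] * pderiv (p j))) mod p j)"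
  define D where "D = of_nat m * f - (\<Sum>j\<in>A. R j * Q j)"
  have pQ: "p j * Q j = (\<Prod>j\<in>A. p j)" if "j \<in> A" for j
    unfolding Q_def using fin that by (simp add: prod.remove)
  \<comment> \<open>The value at 0 shows that 1 - x^m, and with it each of its factors, is
    nonzero.\<close>
  have "poly (1 - [:0, 1:] ^ m) (0 :: 'a) = 1"
    using m by (simp add: poly_power zero_power)
  hence nz: "(\<Prod>j\<in>A. p j) \<noteq> 0"
    unfolding eq [symmetric] by auto
  have coprime: "coprime (p i) (p j)" if "i \<in> A" "j \<in> A" "i \<noteq> j" for i j
  proof (rule coprime_factors_one_minus_X_power[OF _ m])
    have "p i * p j = (\<Prod>l\<in>{i, j}. p l)"
      using that by simp
    also have "\<dots> dvd (\<Prod>l\<in>A. p l)"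
      using that fin by (intro prod_dvd_prod_subset) auto
    finally show "p i * p j dvd 1 - [:0, 1:] ^ m"
      unfolding eq [symmetric] by (rule dvd_mult2)
  qed
  have dvd_D: "p j dvd D" if j: "j \<in> A" for j
  proof -
    have "p j dvd R i * Q i" if "i \<in> A - {j}" for i
      unfolding Q_def using fin that j by (intro dvd_mult dvd_prodI) auto
    hence 1: "p j dvd (\<Sum>i\<in>A - {j}. R i * Q i)"
      by (rule dvd_sum)
    have "p j dvd - (f * g * [:0, 1:] * pderiv (p j)) - R j"
      unfolding R_def by (rule dvd_minus_mod)
    hence 2: "p j dvd (- (f * g * [:0, 1:] * pderiv (p j)) - R j) * Q j"
      by (rule dvd_mult2)
    have "p j dvd of_nat m + [:0, 1:] * pderiv (p j) * (Q j * g)"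
      using m eq pQ[OF j] by (intro factor_dvd_pderiv_one_minus_X_power) (simp_all add: mult.assoc [symmetric])
    hence 3: "p j dvd f * (of_nat m + [:0, 1:] * pderiv (p j) * (Q j * g))"
      by (rule dvd_mult)
    \<comment> \<open>The term f g x p_j' Q_j is added and subtracted; each of the three summands is
      then divisible by \<open>p j\<close>.\<close>
    have "D = f * (of_nat m + [:0, 1:] * pderiv (p j) * (Q j * g)) +
              (- (f * g * [:0, 1:] * pderiv (p j)) - R j) * Q j - (\<Sum>i\<in>A - {j}. R i * Q i)"
      unfolding D_def sum.remove[OF fin j] by algebra
    thus ?thesis
      using 1 2 3 by (simp only: dvd_add dvd_diff)
  qed
  \<comment> \<open>Pairwise coprimality combines the separate divisibilities one factor at a
    time.\<close>
  have "(\<Prod>j\<in>B. p j) dvd D" if "B \<subseteq> A" for B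
    using finite_subset[OF that fin] that
  proof (induction B rule: finite_induct)
    case (insert j B)
    have "coprime (p j) (\<Prod>i\<in>B. p i)"
      using insert.hyps insert.prems by (intro prod_coprime_right coprime) auto
    thus ?case
      using insert dvd_D by (simp add: divides_mult)
  qed simp
  hence "(\<Prod>j\<in>A. p j) dvd D"
    by blast
  moreover have "degree D < degree (\<Prod>j\<in>A. p j)"
    unfolding D_def
  proof (rule degree_diff_less)
    show "degree (of_nat m * f) < degree (\<Prod>j\<in>A. p j)"
      using deg m by (simp add: of_nat_poly)
    show "degree (\<Sum>j\<in>A. R j * Q j) < degree (\<Prod>j\<in>A. p j)"
    proof (rule degree_sum_less)
      show "0 < degree (\<Prod>j\<in>A. p j)"
        using deg by simp
      fix j assume j: "j \<in> A"
      show "degree (R j * Q j) < degree (\<Prod>j\<in>A. p j)"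
      \<comment> \<open>A zero remainder has degree 0, which is not below the degree of a constant
        \<open>p j\<close>; the strict bound on \<open>R j\<close> needs a nonzero
        remainder.\<close>
      proof (cases "R j = 0")
        case True
        thus ?thesis
          using deg by simp
      next
        case False
        have nz': "p j \<noteq> 0" "Q j \<noteq> 0"
          using pQ[OF j] nz by auto
        have "degree (R j) < degree (p j)"
          using False nz' degree_mod_less' unfolding R_def by blast
        thus ?thesis
          unfolding pQ[OF j, symmetric] using nz' False by (simp add: degree_mult_eq)
      qed
    qed
  qed
  ultimately have "D = 0"
    by (rule degree_less_dvd_imp_zero)
  thus ?thesis
    by (simp add: D_def R_def Q_def)
qed

text \<open>Replaces Moebius inversion: by induction the terms at proper divisors agree and
  cancel.\<close>

lemma divisor_sum_eq_imp_eq: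
  fixes f g :: "nat \<Rightarrow> 'a::cancel_comm_monoid_add"
  assumes sums: "\<And>n. n > 0 \<Longrightarrow> (\<Sum>d | d dvd n. f d) = (\<Sum>d | d dvd n. g d)"
    and n: "n > 0"
  shows   "f n = g n"
  using n
proof (induction n rule: less_induct)
  case (less n)
  let ?D = "{d. d dvd n} - {n}"
  have "f n + (\<Sum>d\<in>?D. f d) = g n + (\<Sum>d\<in>?D. g d)"
    using sums[OF less.prems] less.prems by (simp add: sum.remove[of "{d. d dvd n}" n])
  also have "(\<Sum>d\<in>?D. g d) = (\<Sum>d\<in>?D. f d)"
  proof (rule sum.cong [OF refl])
    fix d assume d: "d \<in> ?D"
    hence "d < n" "d > 0"
      using less.prems dvd_imp_le[of d n] by (auto intro!: Nat.gr0I)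
    thus "g d = f d"
      using less.IH by simp
  qed
  finally show ?case
    by simp
qed

text \<open>It is a factor of 1 - x^n, whose value at 0 is 1.\<close>

lemma cyclotomic_poly_nonzero:
  assumes "n > 0"
  shows   "cyclotomic_poly n \<noteq> 0"
proof
  assume "cyclotomic_poly n = 0"
  hence "(0 :: rat poly) = 1 - [:0, 1:] ^ n"
    using assms by (subst prod_cyclotomic_poly [symmetric]) (auto simp: prod_zero_iff intro: exI[of _ n])
  hence "poly 0 (0 :: rat) = poly (1 - [:0, 1:] ^ n) 0"
    by simp
  thus False
    using assms by (simp add: poly_power zero_power)
qed

text \<open>No primitive roots are counted: the degrees sum to n over the divisors of n because the
  product is 1 - x^n, and the totients do so by Gauss's identity.\<close>

lemma degree_cyclotomic_poly:
  assumes "n > 0"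
  shows   "degree (cyclotomic_poly n) = totient n"
  using assms
proof (rule divisor_sum_eq_imp_eq [rotated])
  fix n :: nat assume n: "n > 0"
  have "(\<Sum>d | d dvd n. degree (cyclotomic_poly d)) = degree (\<Prod>d | d dvd n. cyclotomic_poly d)"
    using n by (intro degree_prod_sum_eq [symmetric] cyclotomic_poly_nonzero) (auto intro: dvd_pos_nat)
  also have "\<dots> = degree (1 - [:0, 1:] ^ n :: rat poly)"
    using n by (simp add: prod_cyclotomic_poly)
  also have "\<dots> = degree (monom 1 n - 1 :: rat poly)"
    by (subst degree_minus [symmetric]) (simp add: monom_altdef)
  also have "\<dots> = n"
    using n by (metis degree_monom_eq degree_1 degree_add_eq_left degree_minus diff_conv_add_uminus zero_neq_one)
  also have "\<dots> = (\<Sum>d | d dvd n. totient d)"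
    by (rule totient_divisor_sum [symmetric])
  finally show "(\<Sum>d | d dvd n. degree (cyclotomic_poly d)) = (\<Sum>d | d dvd n. totient d)" .
qed

lemma to_fract_prod: "to_fract (prod f A) = (\<Prod>x\<in>A. to_fract (f x))"
  by (induction A rule: infinite_finite_induct) simp_all

lemma to_fract_of_nat: "to_fract (of_nat n) = of_nat n"
  by (induction n) simp_all

theorem theorem4p1:
  fixes d :: "nat \<Rightarrow> nat" and k m :: nat and f g :: "rat poly"
  assumes d_pos: "\<And>j. j \<in> {1..k} \<Longrightarrow> d j > 0"
    and d_distinct: "inj_on d {1..k}"
    and m_def: "m = Lcm (d ` {1..k})"
    and deg_f: "degree f < (\<Sum>j=1..k. totient (d j))"
    and no_root: "\<And>z :: complex. poly (map_poly of_rat f) z = 0 \<Longrightarrow> z ^ m \<noteq> 1"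
    and g_def: "g = (1 - [:0, 1:] ^ m) div (\<Prod>j=1..k. cyclotomic_poly (d j))"
  shows "to_fract f * (\<Prod>j=1..k. 1 / to_fract (cyclotomic_poly (d j))) =
         (\<Sum>j=1..k.
            to_fract ((- (f * g * [:0, 1:] * pderiv (cyclotomic_poly (d j)))) mod cyclotomic_poly (d j))
              / (of_nat m * to_fract (cyclotomic_poly (d j))))"
proof -
  define p where "p = (\<lambda>j. cyclotomic_poly (d j))"
  define R where "R = (\<lambda>j. (- (f * g * [:0, 1:] * pderiv (p j))) mod p j)"
  have "0 \<notin> d ` {1..k}"
    using d_pos by fastforce
  hence m: "m > 0"
    by (simp add: m_def Lcm_0_iff flip: neq0_conv)
  \<comment> \<open>The division defining \<open>g\<close> is exact, since the \<open>d j\<close>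
    are distinct divisors of \<open>m\<close>.\<close>
  have eq: "(\<Prod>j=1..k. p j) * g = 1 - [:0, 1:] ^ m"
    using prod_cyclotomic_poly_dvd[OF _ d_distinct d_pos]
    unfolding g_def p_def m_def by (intro dvd_mult_div_cancel) auto
  have p_nz: "p j \<noteq> 0" if "j \<in> {1..k}" for j
    using d_pos[OF that] by (simp add: p_def cyclotomic_poly_nonzero)
  have "degree (\<Prod>j=1..k. p j) = (\<Sum>j=1..k. totient (d j))"
    by (subst degree_prod_sum_eq) (use p_nz d_pos in \<open>auto simp: p_def degree_cyclotomic_poly\<close>)
  hence "of_nat m * f = (\<Sum>j=1..k. R j * (\<Prod>i\<in>{1..k} - {j}. p i))"
    unfolding R_def using deg_f by (intro partial_fractions_one_minus_X_power[OF _ m eq]) simp_all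
  from arg_cong[OF this, of to_fract] have main: "of_nat m * to_fract f =
      (\<Sum>j=1..k. to_fract (R j) * (\<Prod>i\<in>{1..k} - {j}. to_fract (p i)))"
    by (simp only: to_fract_of_nat to_fract_mult to_fract_prod to_fract_sum)
  define P where "P = (\<Prod>j=1..k. to_fract (p j))"
  have P_nz: "P \<noteq> 0"
    unfolding P_def using p_nz by (simp add: prod_zero_iff)
  have m_nz: "(of_nat m :: rat poly fract) \<noteq> 0"
    using m by (simp flip: to_fract_of_nat)
  \<comment> \<open>Expanding by m exposes the left-hand side of \<open>main\<close>; dividing its
    sum termwise by m P then cancels the complementary products.\<close>
  have "to_fract f * (\<Prod>j=1..k. 1 / to_fract (p j)) = of_nat m * to_fract f / (of_nat m * P)"
    using m_nz by (simp add: P_def prod_dividef)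
  also have "\<dots> = (\<Sum>j=1..k. to_fract (R j) * (\<Prod>i\<in>{1..k} - {j}. to_fract (p i)) / (of_nat m * P))"
    unfolding main by (rule sum_divide_distrib)
  also have "\<dots> = (\<Sum>j=1..k. to_fract (R j) / (of_nat m * to_fract (p j)))"
  proof (rule sum.cong [OF refl])
    fix j assume j: "j \<in> {1..k}"
    have "P = to_fract (p j) * (\<Prod>i\<in>{1..k} - {j}. to_fract (p i))"
      unfolding P_def using j by (intro prod.remove) auto
    thus "to_fract (R j) * (\<Prod>i\<in>{1..k} - {j}. to_fract (p i)) / (of_nat m * P) =
          to_fract (R j) / (of_nat m * to_fract (p j))"
      using P_nz by simp
  qed
  finally show ?thesis
    by (simp only: p_def R_def)
qed

end
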